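(* Let $1\le p<\infty$, let $d\ge 1$, let $\mathcal{X}$ be a reflexive Banach space and $\mathcal{Y}$ a Banach space over $\mathbb{F}$. Let $\mathcal{T}=(T_1,\dots,T_d)$ and $\mathcal{S}=(S_1,\dots,S_d)$ belong to $\mathcal{K}(\mathcal{X},\ell_p^d(\mathcal{Y}))$, and suppose $\bigcap_{i=1}^d M_{T_i}\neq\emptyset$. Then \[\mathcal{T}\perp_B\mathbb{F}^d\mathcal{S}\quad\Rightarrow\quad T_j\perp_B S_j\ \text{ for each }1\le j\le d.\] Moreover, if each $T_j$ is smooth in $\mathcal{K}(\mathcal{X},\mathcal{Y})$, then \[T_j\perp_B S_j\ \text{ for all }1\le j\le d\quad\Rightarrow\quad\mathcal{T}\perp_B\mathbb{F}^d\mathcal{S}.\]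
   Context: $\mathbb{F}$ is $\mathbb{R}$ or $\mathbb{C}$. $\ell_p^d(\mathcal{Y})$ is the direct sum of $d$ copies of $\mathcal{Y}$ with norm $\|(y_1,\dots,y_d)\|_p=(\sum_{i=1}^d\|y_i\|^p)^{1/p}$. $\mathcal{K}(\mathcal{X},\mathcal{Y})$ is the space of compact linear operators from $\mathcal{X}$ to $\mathcal{Y}$ with the operator norm. A tuple $\mathcal{T}=(T_1,\dots,T_d)$ with $T_k:\mathcal{X}\to\mathcal{Y}$ is identified with the operator $x\mapsto(T_1x,\dots,T_dx)$ into $\ell_p^d(\mathcal{Y})$, and $\|\mathcal{T}\|$ is its operator norm. For $\mathbf{z}=(z_1,\dots,z_d)\in\mathbb{F}^d$, $\mathbf{z}\mathcal{S}=(z_1S_1,\dots,z_dS_d)$, and $\mathbb{F}^d\mathcal{S}=\{\mathbf{z}\mathcal{S}:\mathbf{z}\in\mathbb{F}^d\}$. $S_{\mathcal{X}}$ is the unit sphere of $\mathcal{X}$, and $M_T=\{x\in S_{\mathcal{X}}:\|Tx\|=\|T\|\}$ is the norm attainment set of an operator $T$ on $\mathcal{X}$. Birkhoff-James orthogonality: for elements $x,y$ of a Banach space, $x\perp_B y$ means $\|x+\lambda y\|\ge\|x\|$ for all $\lambda\in\mathbb{F}$; for a subspace $W$, $x\perp_B W$ means $x\perp_B w$ for all $w\in W$. A nonzero element $x$ of a Banach space $\mathcal{Z}$ is smooth if $J(x)=\{f\in\mathcal{Z}^*:\|f\|=1,\ f(x)=\|x\|\}$ is a singleton. *)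

theory Defs
  imports "HOL-Analysis.Analysis"
begin

text \<open>The scalar field: \<open>\<real>\<close> or \<open>\<complex>\<close>. The norm is multiplicative (it is a \<^class>\<open>real_normed_field\<close>),
  hence it is the usual absolute value in both cases.\<close>

class real_or_complex = real_normed_field +
  assumes real_or_complex:
    "(\<forall>x. \<exists>a. x = a *\<^sub>R 1) \<or>
     (\<exists>i. i * i = - 1 \<and> (\<forall>x. \<exists>a b. x = a *\<^sub>R 1 + b *\<^sub>R i))"

instance real :: real_or_complex
  by standard auto

instance complex :: real_or_complex
proof
  have "\<forall>x. \<exists>a b. x = a *\<^sub>R 1 + b *\<^sub>R \<i>"
  proof
    fix x
    have "x = Re x *\<^sub>R 1 + Im x *\<^sub>R \<i>"
      by (simp add: complex_eq_iff)
    then show "\<exists>a b. x = a *\<^sub>R 1 + b *\<^sub>R \<i>" by blast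
  qed
  then show "(\<forall>x::complex. \<exists>a. x = a *\<^sub>R 1) \<or>
     (\<exists>i::complex. i * i = - 1 \<and> (\<forall>x. \<exists>a b. x = a *\<^sub>R 1 + b *\<^sub>R i))"
    by (intro disjI2 exI[of _ \<i>]) simp
qed

text \<open>A normed space over the scalar field \<open>'f\<close> is a real normed space with a compatible
  multiplication by scalars from \<open>'f\<close>. It is a Banach space if its type is of class
  \<^class>\<open>banach\<close>.\<close>

locale normed_space_over = vector_space smul
  for smul :: "'f::real_or_complex \<Rightarrow> 'v::real_normed_vector \<Rightarrow> 'v" +
  assumes scale_of_real: "smul (of_real r) x = r *\<^sub>R x"
    and norm_scale: "norm (smul c x) = norm c * norm x"
begin

lemma bounded_linear_scale: "bounded_linear (smul c)"
proof (rule bounded_linear_intro)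
  fix x y :: 'v and r :: real
  show "smul c (x + y) = smul c x + smul c y"
    by (rule scale_right_distrib)
  show "smul c (r *\<^sub>R x) = r *\<^sub>R smul c x"
    by (metis scale_of_real scale_left_commute)
  show "norm (smul c x) \<le> norm x * norm c"
    by (simp add: norm_scale mult.commute)
qed

end

lemma normed_space_over_scaleR:
  "normed_space_over (scaleR :: real \<Rightarrow> 'v::real_normed_vector \<Rightarrow> 'v)"
  by unfold_locales (auto simp: algebra_simps)

lemma normed_space_over_field:
  "normed_space_over ((*) :: 'f::real_or_complex \<Rightarrow> 'f \<Rightarrow> 'f)"
  by unfold_locales (auto simp: algebra_simps norm_mult scaleR_conv_of_real)

definition scale_op ::
    "('f \<Rightarrow> 'y \<Rightarrow> 'y) \<Rightarrow> 'f \<Rightarrow> ('x \<Rightarrow>\<^sub>L 'y) \<Rightarrow>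
     ('x::real_normed_vector \<Rightarrow>\<^sub>L 'y::real_normed_vector)" where
  "scale_op smul c T = Blinfun (\<lambda>x. smul c (blinfun_apply T x))"

lemma (in normed_space_over) scale_op_apply:
  "blinfun_apply (scale_op smul c T) x = smul c (blinfun_apply T x)"
  unfolding scale_op_def
  by (subst bounded_linear_Blinfun_apply)
    (auto intro: bounded_linear_compose[OF bounded_linear_scale] blinfun.bounded_linear_right)

subsection \<open>Duals, reflexivity, smoothness\<close>

text \<open>The dual of a linear subspace \<open>V\<close> of a normed space. Functionals on \<open>V\<close> are represented by
  functions that are \<^const>\<open>undefined\<close> outside \<open>V\<close>, so that equality of functions is equality of
  functionals on \<open>V\<close>.\<close>

definition dual_on ::
    "('f::real_or_complex \<Rightarrow> 'v \<Rightarrow> 'v) \<Rightarrow> 'v::real_normed_vector set \<Rightarrow> ('v \<Rightarrow> 'f) set" where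
  "dual_on smul V = {f \<in> extensional V.
     (\<forall>x\<in>V. \<forall>y\<in>V. f (x + y) = f x + f y) \<and>
     (\<forall>c. \<forall>x\<in>V. f (smul c x) = c * f x) \<and>
     (\<exists>B. \<forall>x\<in>V. norm (f x) \<le> B * norm x)}"

definition dual_norm :: "'v::real_normed_vector set \<Rightarrow> ('v \<Rightarrow> 'f::real_normed_vector) \<Rightarrow> real" where
  "dual_norm V f = (SUP x\<in>V. norm (f x) / norm x)"

definition support_functionals ::
    "('f::real_or_complex \<Rightarrow> 'v \<Rightarrow> 'v) \<Rightarrow> 'v::real_normed_vector set \<Rightarrow> 'v \<Rightarrow> ('v \<Rightarrow> 'f) set" where
  "support_functionals smul V x =
     {f \<in> dual_on smul V. dual_norm V f = 1 \<and> f x = of_real (norm x)}"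

definition smooth_in ::
    "('f::real_or_complex \<Rightarrow> 'v \<Rightarrow> 'v) \<Rightarrow> 'v::real_normed_vector set \<Rightarrow> 'v \<Rightarrow> bool" where
  "smooth_in smul V x \<longleftrightarrow>
     x \<in> V \<and> x \<noteq> 0 \<and> is_singleton (support_functionals smul V x)"

definition cont_dual ::
    "('f::real_or_complex \<Rightarrow> 'x \<Rightarrow> 'x) \<Rightarrow> ('x::real_normed_vector \<Rightarrow>\<^sub>L 'f) set" where
  "cont_dual smul = {f. Vector_Spaces.linear smul (*) (blinfun_apply f)}"

definition reflexive_space ::
    "('f::real_or_complex \<Rightarrow> 'x \<Rightarrow> 'x::real_normed_vector) \<Rightarrow> bool" where
  "reflexive_space smul \<longleftrightarrow>
     (\<forall>\<phi> \<in> dual_on (scale_op (*)) (cont_dual smul).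
        \<exists>x. \<forall>f \<in> cont_dual smul. \<phi> f = blinfun_apply f x)"

subsection \<open>Compact operators, norm attainment and tuples\<close>

definition compact_map :: "'y topology \<Rightarrow> ('x::real_normed_vector \<Rightarrow> 'y) \<Rightarrow> bool" where
  "compact_map Y T \<longleftrightarrow> compactin Y (Y closure_of (T ` cball 0 1))"

definition compact_ops ::
    "('f::real_or_complex \<Rightarrow> 'x \<Rightarrow> 'x) \<Rightarrow> ('f \<Rightarrow> 'y \<Rightarrow> 'y) \<Rightarrow>
     ('x::real_normed_vector \<Rightarrow>\<^sub>L 'y::real_normed_vector) set" where
  "compact_ops scaleX scaleY =
     {T. Vector_Spaces.linear scaleX scaleY (blinfun_apply T) \<and>
         compact_map euclidean (blinfun_apply T)}"

definition norm_attainment_set ::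
    "('x::real_normed_vector \<Rightarrow>\<^sub>L 'y::real_normed_vector) \<Rightarrow> 'x set" where
  "norm_attainment_set T = {x. norm x = 1 \<and> norm (blinfun_apply T x) = norm T}"

text \<open>The library norm on \<open>'y ^ 'd\<close> is the one for \<open>p = 2\<close>; it plays no role below.\<close>

definition lp_norm :: "real \<Rightarrow> 'y::real_normed_vector ^ 'd \<Rightarrow> real" where
  "lp_norm p y = (\<Sum>k\<in>UNIV. norm (y $ k) powr p) powr (1 / p)"

definition lp_topology :: "real \<Rightarrow> ('y::real_normed_vector ^ 'd) topology" where
  "lp_topology p = Metric_space.mtopology UNIV (\<lambda>u v. lp_norm p (u - v))"

definition tuple_op ::
    "('x::real_normed_vector \<Rightarrow>\<^sub>L 'y::real_normed_vector) ^ 'd \<Rightarrow> 'x \<Rightarrow> 'y ^ 'd" where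
  "tuple_op T x = (\<chi> k. blinfun_apply (T $ k) x)"

text \<open>The operator norm into the \<open>p\<close>-sum, in the form of the library constant \<^const>\<open>onorm\<close>.\<close>

definition tuple_norm ::
    "real \<Rightarrow> ('x::real_normed_vector \<Rightarrow>\<^sub>L 'y::real_normed_vector) ^ 'd \<Rightarrow> real" where
  "tuple_norm p T = (SUP x. lp_norm p (tuple_op T x) / norm x)"

definition compact_tuples ::
    "real \<Rightarrow> ('f::real_or_complex \<Rightarrow> 'x \<Rightarrow> 'x) \<Rightarrow> ('f \<Rightarrow> 'y \<Rightarrow> 'y) \<Rightarrow>
     (('x::real_normed_vector \<Rightarrow>\<^sub>L 'y::real_normed_vector) ^ 'd) set" where
  "compact_tuples p scaleX scaleY =
     {T. Vector_Spaces.linear scaleX (\<lambda>c y. \<chi> k. scaleY c (y $ k)) (tuple_op T) \<and>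
         compact_map (lp_topology p) (tuple_op T)}"

definition tuple_mult ::
    "('f \<Rightarrow> 'y \<Rightarrow> 'y) \<Rightarrow> 'f ^ 'd \<Rightarrow> ('x \<Rightarrow>\<^sub>L 'y) ^ 'd \<Rightarrow>
     ('x::real_normed_vector \<Rightarrow>\<^sub>L 'y::real_normed_vector) ^ 'd" where
  "tuple_mult scaleY z S = (\<chi> k. scale_op scaleY (z $ k) (S $ k))"

definition tuple_scale ::
    "('f \<Rightarrow> 'y \<Rightarrow> 'y) \<Rightarrow> 'f \<Rightarrow> ('x \<Rightarrow>\<^sub>L 'y) ^ 'd \<Rightarrow>
     ('x::real_normed_vector \<Rightarrow>\<^sub>L 'y::real_normed_vector) ^ 'd" where
  "tuple_scale scaleY c S = (\<chi> k. scale_op scaleY c (S $ k))"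

subsection \<open>Birkhoff-James orthogonality\<close>

text \<open>The norm is a parameter, because the same notion is needed for \<^const>\<open>tuple_norm\<close>.\<close>

definition bj_orth ::
    "('f \<Rightarrow> 'v \<Rightarrow> 'v) \<Rightarrow> ('v \<Rightarrow> real) \<Rightarrow> 'v::plus \<Rightarrow> 'v \<Rightarrow> bool" where
  "bj_orth smul nrm x y \<longleftrightarrow> (\<forall>c. nrm (x + smul c y) \<ge> nrm x)"

definition bj_orth_set ::
    "('f \<Rightarrow> 'v \<Rightarrow> 'v) \<Rightarrow> ('v \<Rightarrow> real) \<Rightarrow> 'v::plus \<Rightarrow> 'v set \<Rightarrow> bool" where
  "bj_orth_set smul nrm x W \<longleftrightarrow> (\<forall>w\<in>W. bj_orth smul nrm x w)"

end

theory Submission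
  imports Defs
begin

text \<open>Fix a unit vector \<open>x\<close> at which all components \<open>T\<^sub>j\<close> attain their norms. Every tuple \<open>U\<close> satisfies
  \<open>\<parallel>U\<parallel>\<^sup>p \<le> (\<Sum>k. \<parallel>U\<^sub>k\<parallel>\<^sup>p)\<close>, and \<open>x\<close> shows that equality holds for \<open>T\<close>. In other words the tuple
  norm is dominated by the \<open>p\<close>-norm \<^const>\<open>lp_norm\<close> of the operator norms of the components, with
  equality at \<open>T\<close> (\<open>tuple_norm_le_lp_norm\<close>, \<open>tuple_norm_eq_lp_norm\<close>).

  If adding \<open>c S\<^sub>j\<close> decreased the norm of \<open>T\<^sub>j\<close>, then perturbing \<open>T\<close> in its \<open>j\<close>-th component only would
  strictly decrease this \<open>p\<close>-norm and therefore bring the tuple norm below \<open>\<parallel>T\<parallel>\<close>. That is the first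
  implication.

  For the second one, orthogonality is first moved from the operators to the point \<open>x\<close>. By the
  Hahn-Banach theorem, \<open>T\<^sub>j\<close> has a support functional that annihilates \<open>S\<^sub>j\<close>. On the other hand, if
  \<open>g\<close> is a support functional of \<open>T\<^sub>j x\<close> in the range space, then \<open>A \<mapsto> g (A x)\<close> is a support functional
  of \<open>T\<^sub>j\<close>. Smoothness makes the two coincide on the compact operators, so \<open>g (S\<^sub>j x) = 0\<close>, and \<open>g\<close>
  witnesses that \<open>T\<^sub>j x\<close> is orthogonal to \<open>S\<^sub>j x\<close> (\<open>smooth_bj_orth_imp_bj_orth_at\<close>). Evaluating
  a perturbed tuple at the single vector \<open>x\<close> then already gives a norm of at least \<open>\<parallel>T\<parallel>\<close>.

  The Hahn-Banach theorem enters in the form that every sublinear functional dominates a linear one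
  that agrees with it at a given point. The linear functional is found as a minimal element among
  the sublinear functionals, so no extension from subspaces is involved.\<close>

section \<open>Linear minorants of sublinear functionals\<close>

text \<open>Homogeneity is required as an inequality only, which is easier to check for infima; equality
  follows by scaling back (\<open>sublinear_scale\<close>).\<close>

definition sublinear :: "('v::real_vector \<Rightarrow> real) \<Rightarrow> bool" where
  "sublinear q \<longleftrightarrow>
     (\<forall>x y. q (x + y) \<le> q x + q y) \<and> (\<forall>t x. 0 \<le> t \<longrightarrow> q (t *\<^sub>R x) \<le> t * q x)"

lemma sublinear_add: "sublinear q \<Longrightarrow> q (x + y) \<le> q x + q y"
  by (simp add: sublinear_def)

lemma sublinear_scale_le: "sublinear q \<Longrightarrow> 0 \<le> t \<Longrightarrow> q (t *\<^sub>R x) \<le> t * q x"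
  by (simp add: sublinear_def)

lemma sublinear_zero:
  assumes "sublinear q" shows "q 0 = 0"
  using sublinear_scale_le[OF assms, of 0 0] sublinear_add[OF assms, of 0 0] by simp

lemma sublinear_scale:
  assumes q: "sublinear q" and t: "0 \<le> t"
  shows "q (t *\<^sub>R x) = t * q x"
proof (cases "t = 0")
  case True
  then show ?thesis by (simp add: sublinear_zero[OF q])
next
  case False
  then have "t > 0" using t by simp
  have "q (inverse t *\<^sub>R (t *\<^sub>R x)) \<le> inverse t * q (t *\<^sub>R x)"
    using t by (intro sublinear_scale_le[OF q]) simp
  then have "t * q x \<le> q (t *\<^sub>R x)"
    using \<open>t > 0\<close> by (simp add: field_simps)
  then show ?thesis using sublinear_scale_le[OF q t, of x] by simp
qed

lemma sublinear_minus: "sublinear q \<Longrightarrow> - q (- x) \<le> q x"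
  using sublinear_add[of q x "- x"] sublinear_zero[of q] by simp

text \<open>If a linear \<open>l \<le> q\<close> agrees with \<open>q\<close> at \<open>y\<close>, then
  \<open>l x = l (x + t y) - t q y \<le> q (x + t y) - t q y\<close> for all \<open>t \<ge> 0\<close>. The infimum of these bounds is
  again sublinear and lies below \<open>q\<close>; conversely, every linear functional below it agrees with \<open>q\<close>
  at \<open>y\<close>.\<close>

definition sweep :: "('v::real_vector \<Rightarrow> real) \<Rightarrow> 'v \<Rightarrow> 'v \<Rightarrow> real" where
  "sweep q y x = (INF t\<in>{0..}. q (x + t *\<^sub>R y) - t * q y)"

lemma sweep_le:
  assumes q: "sublinear q" and t: "0 \<le> t"
  shows "sweep q y x \<le> q (x + t *\<^sub>R y) - t * q y"
  unfolding sweep_def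
proof (rule cINF_lower)
  have "- q (- x) \<le> q (x + s *\<^sub>R y) - s * q y" if "s \<ge> 0" for s
    using sublinear_add[OF q, of "- x" "x + s *\<^sub>R y"] sublinear_scale[OF q that, of y] by simp
  then show "bdd_below ((\<lambda>t. q (x + t *\<^sub>R y) - t * q y) ` {0..})"
    by (intro bdd_belowI2[of _ "- q (- x)"]) simp
qed (use t in simp)

lemma sweep_greatest: "(\<And>t. 0 \<le> t \<Longrightarrow> m \<le> q (x + t *\<^sub>R y) - t * q y) \<Longrightarrow> m \<le> sweep q y x"
  unfolding sweep_def by (rule cINF_greatest) auto

lemma sweep_le_self: "sublinear q \<Longrightarrow> sweep q y x \<le> q x"
  using sweep_le[of q 0 y x] by simp

lemma sublinear_sweep:
  assumes q: "sublinear q" shows "sublinear (sweep q y)"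
  unfolding sublinear_def
proof (intro conjI allI impI)
  fix x x'
  have "sweep q y (x + x') - (q (x' + s *\<^sub>R y) - s * q y) \<le> q (x + t *\<^sub>R y) - t * q y"
    if "s \<ge> 0" "t \<ge> 0" for s t
  proof -
    have "sweep q y (x + x') \<le> q ((x + t *\<^sub>R y) + (x' + s *\<^sub>R y)) - (t + s) * q y"
      using sweep_le[OF q, of "t + s" y "x + x'"] that by (simp add: algebra_simps)
    also have "\<dots> \<le> q (x + t *\<^sub>R y) + q (x' + s *\<^sub>R y) - (t + s) * q y"
      using sublinear_add[OF q] by simp
    finally show ?thesis by (simp add: algebra_simps)
  qed
  then have "sweep q y (x + x') - (q (x' + s *\<^sub>R y) - s * q y) \<le> sweep q y x" if "s \<ge> 0" for s
    using that by (intro sweep_greatest) auto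
  then have "sweep q y (x + x') - sweep q y x \<le> sweep q y x'"
    by (intro sweep_greatest) (auto simp: algebra_simps)
  then show "sweep q y (x + x') \<le> sweep q y x + sweep q y x'" by simp
next
  fix c :: real and x
  assume c: "0 \<le> c"
  show "sweep q y (c *\<^sub>R x) \<le> c * sweep q y x"
  proof (cases "c = 0")
    case True
    then show ?thesis using sweep_le_self[OF q, of y 0] by (simp add: sublinear_zero[OF q])
  next
    case False
    have "sweep q y (c *\<^sub>R x) / c \<le> q (x + t *\<^sub>R y) - t * q y" if t: "0 \<le> t" for t
    proof -
      have "sweep q y (c *\<^sub>R x) \<le> q (c *\<^sub>R (x + t *\<^sub>R y)) - (c * t) * q y"
        using sweep_le[OF q, of "c * t" y "c *\<^sub>R x"] c t by (simp add: algebra_simps)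
      also have "\<dots> = c * (q (x + t *\<^sub>R y) - t * q y)"
        unfolding sublinear_scale[OF q c] by (simp add: algebra_simps)
      finally show ?thesis using c False by (simp add: field_simps)
    qed
    then have "sweep q y (c *\<^sub>R x) / c \<le> sweep q y x" by (rule sweep_greatest)
    then show ?thesis using c False by (simp add: field_simps)
  qed
qed

text \<open>Zorn's lemma applies because the members of a chain below \<open>q\<close> are bounded below at \<open>x\<close> by
  \<open>- q (- x)\<close>, so that their pointwise infimum exists; it is again sublinear.\<close>

lemma exists_minimal_sublinear:
  fixes q :: "'v::real_vector \<Rightarrow> real"
  assumes q: "sublinear q"
  obtains m where "sublinear m" "m \<le> q" "\<And>r. sublinear r \<Longrightarrow> r \<le> m \<Longrightarrow> r = m"
proof -
  define A where "A = {r. sublinear r \<and> r \<le> q}"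
  have "\<exists>m\<in>A. \<forall>r\<in>A. r \<le> m \<longrightarrow> r = m"
  proof (rule predicate_Zorn)
    show "partial_order_on A (relation_of (\<lambda>f g. g \<le> f) A)"
      by (rule partial_order_on_relation_ofI) auto
  next
    fix C assume "C \<in> Chains (relation_of (\<lambda>f g. g \<le> f) A)"
    then have CA: "C \<subseteq> A" and chain: "\<And>r s. r \<in> C \<Longrightarrow> s \<in> C \<Longrightarrow> r \<le> s \<or> s \<le> r"
      by (auto simp: Chains_def relation_of_def)
    show "\<exists>u\<in>A. \<forall>a\<in>C. u \<le> a"
    proof (cases "C = {}")
      case True
      have "q \<in> A" using q by (simp add: A_def)
      with True show ?thesis by blast
    next
      case False
      define u where "u x = (INF r\<in>C. r x)" for x
      have lin: "sublinear r" "r \<le> q" if "r \<in> C" for r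
        using that CA by (auto simp: A_def)
      have "- q (- x) \<le> r x" if "r \<in> C" for r x
        using sublinear_minus[OF lin(1)[OF that], of x] le_funD[OF lin(2)[OF that], of "- x"]
        by simp
      then have lower: "u x \<le> r x" if "r \<in> C" for r x
        unfolding u_def using that by (intro cINF_lower bdd_belowI2[of _ "- q (- x)"]) auto
      have greatest: "m \<le> u x" if "\<And>r. r \<in> C \<Longrightarrow> m \<le> r x" for m x
        unfolding u_def using False that by (intro cINF_greatest) auto
      have "sublinear u"
        unfolding sublinear_def
      proof (intro conjI allI impI)
        fix x y
        have "u (x + y) - s y \<le> r x" if rs: "r \<in> C" "s \<in> C" for r s
        proof -
          \<comment> \<open>Of two members of the chain, the smaller one bounds the value at the sum.\<close>
          obtain t where t: "t \<in> C" "t \<le> r" "t \<le> s"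
            using chain[OF rs] rs by blast
          have "u (x + y) \<le> t x + t y"
            using lower[OF t(1), of "x + y"] sublinear_add[OF lin(1)[OF t(1)], of x y] by simp
          then show ?thesis using le_funD[OF t(2), of x] le_funD[OF t(3), of y] by simp
        qed
        then have "u (x + y) - s y \<le> u x" if "s \<in> C" for s
          using that by (intro greatest) auto
        then have "u (x + y) - u x \<le> u y"
          by (intro greatest) (auto simp: algebra_simps)
        then show "u (x + y) \<le> u x + u y" by simp
      next
        fix t :: real and x
        assume t: "0 \<le> t"
        obtain r0 where r0: "r0 \<in> C" using False by blast
        show "u (t *\<^sub>R x) \<le> t * u x"
        proof (cases "t = 0")
          case True
          then show ?thesis using lower[OF r0, of 0] sublinear_zero[OF lin(1)[OF r0]] by simp
        next
          case False
          have "u (t *\<^sub>R x) / t \<le> r x" if "r \<in> C" for r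
            using lower[OF that, of "t *\<^sub>R x"] sublinear_scale[OF lin(1)[OF that] t, of x] t False
            by (simp add: field_simps)
          then have "u (t *\<^sub>R x) / t \<le> u x" by (rule greatest)
          then show ?thesis using t False by (simp add: field_simps)
        qed
      qed
      moreover have "u \<le> q"
        using False lower lin(2) by (metis equals0I le_fun_def order_trans)
      ultimately have "u \<in> A" by (simp add: A_def)
      then show ?thesis using lower by (auto simp: le_fun_def)
    qed
  qed
  then obtain m where m: "m \<in> A" "\<And>r. r \<in> A \<Longrightarrow> r \<le> m \<Longrightarrow> r = m" by blast
  show ?thesis
  proof (rule that)
    show "sublinear m" "m \<le> q" using m(1) by (auto simp: A_def)
    show "r = m" if "sublinear r" "r \<le> m" for r
      using m(1) that by (intro m(2)) (auto simp: A_def)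
  qed
qed

text \<open>Sweeping in direction \<open>y\<close> cannot decrease a minimal \<open>m\<close>; the bound at \<open>t = 1\<close> then is the
  superadditivity \<open>m x + m y \<le> m (x + y)\<close>.\<close>

lemma linear_if_minimal_sublinear:
  assumes m: "sublinear m" and min: "\<And>r. sublinear r \<Longrightarrow> r \<le> m \<Longrightarrow> r = m"
  shows "linear m"
proof -
  have add: "m (x + y) = m x + m y" for x y
  proof -
    have "sweep m y = m"
      using sublinear_sweep[OF m] sweep_le_self[OF m] by (intro min) (auto simp: le_fun_def)
    then have "m x \<le> m (x + y) - m y" using sweep_le[OF m, of 1 y x] by simp
    then show ?thesis using sublinear_add[OF m, of x y] by simp
  qed
  have minus: "m (- x) = - m x" for x
    using add[of x "- x"] sublinear_zero[OF m] by simp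
  have "m (t *\<^sub>R x) = t * m x" for t x
  proof (cases "t \<ge> 0")
    case False
    then have "m ((- t) *\<^sub>R x) = (- t) * m x" by (intro sublinear_scale[OF m]) simp
    then show ?thesis using minus[of "t *\<^sub>R x"] by simp
  qed (rule sublinear_scale[OF m])
  then show ?thesis using add by (intro linearI) auto
qed

text \<open>The Hahn-Banach theorem. To force equality at \<open>x\<close>, the minimal functional is taken below
  \<open>sweep q x\<close> instead of \<open>q\<close>.\<close>

lemma exists_linear_minorant:
  assumes q: "sublinear q"
  obtains f where "linear f" "\<And>v. f v \<le> q v" "f x = q x"
proof -
  obtain f where f: "sublinear f" "f \<le> sweep q x" "\<And>r. sublinear r \<Longrightarrow> r \<le> f \<Longrightarrow> r = f"
    using exists_minimal_sublinear[OF sublinear_sweep[OF q]] by blast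
  have lin: "linear f" by (rule linear_if_minimal_sublinear[OF f(1,3)])
  have le: "f v \<le> q v" for v
    using le_funD[OF f(2), of v] sweep_le_self[OF q, of x v] by simp
  have "f (- x) \<le> - q x"
    using le_funD[OF f(2), of "- x"] sweep_le[OF q, of 1 x "- x"] sublinear_zero[OF q] by simp
  then have "q x \<le> f x" using linear_neg[OF lin, of x] by simp
  then show ?thesis using that[OF lin le] le[of x] by simp
qed

section \<open>Scalar-linear functionals\<close>

text \<open>A multiplicative norm cannot exceed the usual modulus: the powers of a point on the unit circle
  stay on the circle and hence are bounded in norm, which forces its norm to be at most 1.\<close>

lemma norm_of_real_plus_imaginary_le:
  fixes i :: "'f::real_normed_field"
  assumes i: "i * i = - 1"
  shows "norm (of_real a + of_real b * i) \<le> sqrt (a\<^sup>2 + b\<^sup>2)"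
proof (cases "a\<^sup>2 + b\<^sup>2 = 0")
  case True
  then show ?thesis by (simp add: sum_power2_eq_zero_iff)
next
  case False
  define r where "r = sqrt (a\<^sup>2 + b\<^sup>2)"
  have r: "r > 0" "r\<^sup>2 = a\<^sup>2 + b\<^sup>2"
    using False by (auto simp: r_def less_le sum_power2_ge_zero)
  define \<alpha> \<beta> where "\<alpha> = a / r" and "\<beta> = b / r"
  define u where "u = of_real \<alpha> + of_real \<beta> * i"
  have circle: "\<alpha>\<^sup>2 + \<beta>\<^sup>2 = 1"
    using r(1) by (simp add: \<alpha>_def \<beta>_def power_divide add_divide_distrib[symmetric] flip: r(2))
  have norm_i: "norm i = 1"
  proof -
    have "(norm i)\<^sup>2 = 1" using arg_cong[OF i, of norm] by (simp add: norm_mult power2_eq_square)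
    then show ?thesis by (simp add: power2_eq_1_iff) (smt (verit) norm_ge_zero)
  qed
  have powers: "\<exists>c s. u ^ k = of_real c + of_real s * i \<and> c\<^sup>2 + s\<^sup>2 = 1" for k
  proof (induction k)
    case 0
    show ?case by (intro exI[of _ 1] exI[of _ 0]) simp
  next
    case (Suc k)
    then obtain c s where cs: "u ^ k = of_real c + of_real s * i" "c\<^sup>2 + s\<^sup>2 = 1" by blast
    have "u ^ Suc k = u * (of_real c + of_real s * i)" by (simp add: cs(1))
    also have "\<dots> = of_real (\<alpha> * c) + of_real (\<alpha> * s + \<beta> * c) * i
        + of_real (\<beta> * s) * (i * i)"
      by (simp add: u_def algebra_simps)
    also have "\<dots> = of_real (\<alpha> * c - \<beta> * s) + of_real (\<alpha> * s + \<beta> * c) * i"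
      by (simp add: i)
    finally have "u ^ Suc k = \<dots>" .
    moreover have "(\<alpha> * c - \<beta> * s)\<^sup>2 + (\<alpha> * s + \<beta> * c)\<^sup>2
        = (\<alpha>\<^sup>2 + \<beta>\<^sup>2) * (c\<^sup>2 + s\<^sup>2)"
      by algebra
    ultimately show ?case using circle cs(2) by (metis mult_1)
  qed
  have bound: "norm u ^ k \<le> 2" for k
  proof -
    obtain c s where cs: "u ^ k = of_real c + of_real s * i" "c\<^sup>2 + s\<^sup>2 = 1"
      using powers by blast
    have "\<bar>c\<bar> \<le> 1" "\<bar>s\<bar> \<le> 1"
      using cs(2) by (auto simp: abs_square_le_1[symmetric]) (smt (verit) zero_le_power2)+
    moreover have "norm (u ^ k) \<le> \<bar>c\<bar> + \<bar>s\<bar>"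
      unfolding cs(1) by (rule norm_triangle_le) (simp add: norm_mult norm_i)
    ultimately show ?thesis by (simp add: norm_power)
  qed
  \<comment> \<open>A number whose powers stay bounded has norm at most 1.\<close>
  have "norm u \<le> 1"
  proof (rule ccontr)
    assume "\<not> norm u \<le> 1"
    then obtain k where "2 < norm u ^ k" using real_arch_pow[of "norm u" 2] by auto
    then show False using bound[of k] by simp
  qed
  moreover have "of_real a + of_real b * i = of_real r * u"
    using r(1) by (simp add: u_def \<alpha>_def \<beta>_def distrib_left)
  ultimately show ?thesis using r(1) by (simp add: norm_mult r_def)
qed

text \<open>The product of \<open>a + b i\<close> and its conjugate is \<open>a\<^sup>2 + b\<^sup>2\<close>, and the modulus bounds the norm of the
  conjugate from above; so the norm of \<open>a + b i\<close> is bounded below by its modulus.\<close>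

lemma imaginary_part_zero:
  fixes i :: "'f::real_normed_field"
  assumes i: "i * i = - 1" and le: "norm (of_real a + of_real b * i) \<le> a"
  shows "b = 0"
proof (rule ccontr)
  assume b: "b \<noteq> 0"
  define r where "r = sqrt (a\<^sup>2 + b\<^sup>2)"
  have r: "r > 0" "r * r = a\<^sup>2 + b\<^sup>2"
    using b by (auto simp: r_def sum_power2_gt_zero_iff simp flip: power2_eq_square)
  have "(of_real a + of_real b * i) * (of_real a + of_real (- b) * i)
      = of_real (a\<^sup>2) - of_real (b\<^sup>2) * (i * i)"
    by (simp add: algebra_simps power2_eq_square)
  also have "\<dots> = of_real (r * r)" by (simp add: i r(2))
  finally have "norm (of_real a + of_real b * i) * norm (of_real a + of_real (- b) * i) = r * r"
    by (metis norm_mult norm_of_real abs_of_nonneg zero_le_square)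
  moreover have "norm (of_real a + of_real (- b) * i) \<le> r"
    using norm_of_real_plus_imaginary_le[OF i, of a "- b"] by (simp add: r_def)
  ultimately have "r * r \<le> norm (of_real a + of_real b * i) * r"
    by (metis mult_left_mono norm_ge_zero)
  then have "r \<le> a" using r(1) le by simp
  moreover have "a < r" using b real_less_rsqrt[of a "a\<^sup>2 + b\<^sup>2"] by (simp add: r_def)
  ultimately show False by simp
qed

text \<open>Over the complex numbers, a real-linear \<open>f\<close> is the real part of the complex-linear
  \<open>F v = f v - i f (i v)\<close>. The bound \<open>f \<le> norm\<close> carries over to \<open>F\<close>, and with it the value of \<open>F x\<close> is
  forced to be real.\<close>

lemma (in normed_space_over) real_linear_imp_scalar_linear:
  fixes f :: "'v \<Rightarrow> real"
  assumes lin: "linear f" and le: "\<And>v. f v \<le> norm v" and x: "f x = norm x"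
    and y: "\<And>c. f (smul c y) = 0"
  obtains F where "\<And>v w. F (v + w) = F v + F w" "\<And>c v. F (smul c v) = c * F v"
    "\<And>v. norm (F v) \<le> norm v" "F x = of_real (norm x)" "F y = 0"
proof -
  note add = linear_add[OF lin]
  have scale: "f (smul (of_real a) v) = a * f v" for a v
    by (simp add: scale_of_real linear_cmul[OF lin])
  have abs: "\<bar>f v\<bar> \<le> norm v" for v
    using le[of v] le[of "- v"] by (simp add: linear_neg[OF lin])
  consider "\<forall>c::'f. \<exists>a. c = a *\<^sub>R 1"
    | i :: 'f where "i * i = - 1" "\<forall>c. \<exists>a b. c = a *\<^sub>R 1 + b *\<^sub>R i"
    using real_or_complex by blast
  then show ?thesis
  proof cases
    case 1
    define F :: "'v \<Rightarrow> 'f" where "F v = of_real (f v)" for v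
    have "F (smul c v) = c * F v" for c v
    proof -
      obtain a where "c = of_real a" using 1 by (metis scaleR_conv_of_real mult_1_right)
      then show ?thesis by (simp add: F_def scale)
    qed
    then show ?thesis
      using abs y[of 1] by (intro that[of F]) (auto simp: F_def add x)
  next
    case 2
    have decomp: "\<exists>a b. c = of_real a + of_real b * i" for c
      using 2(2) by (metis scaleR_conv_of_real mult_1_right)
    define F where "F v = of_real (f v) + of_real (- f (smul i v)) * i" for v
    have F_add: "F (v + w) = F v + F w" for v w
      by (simp add: F_def add scale_right_distrib algebra_simps)
    have F_real: "F (smul (of_real a) v) = of_real a * F v" for a v
    proof -
      have "f (smul i (smul (of_real a) v)) = a * f (smul i v)"
        by (metis scale scale_left_commute)
      then show ?thesis by (simp add: F_def scale algebra_simps del: scale_scale)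
    qed
    have F_i: "F (smul i v) = i * F v" for v
    proof -
      have "smul i (smul i v) = - v" by (simp add: 2(1))
      moreover have "of_real (f v) * i - of_real (f (smul i v)) * (i * i)
          = i * (of_real (f v) - of_real (f (smul i v)) * i)" by (simp add: algebra_simps)
      ultimately show ?thesis by (simp add: F_def linear_neg[OF lin] 2(1) add.commute)
    qed
    have F_scale: "F (smul c v) = c * F v" for c v
    proof -
      obtain a b where c: "c = of_real a + of_real b * i" using decomp by blast
      have "smul c v = smul (of_real a) v + smul (of_real b) (smul i v)"
        by (simp add: c scale_left_distrib)
      then have "F (smul c v) = of_real a * F v + of_real b * (i * F v)"
        by (simp only: F_add F_real F_i)
      then show ?thesis by (simp add: c algebra_simps)
    qed
    have F_le: "norm (F v) \<le> norm v" for v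
    proof (cases "F v = 0")
      case False
      \<comment> \<open>Rotate \<open>v\<close> so that \<open>F\<close> becomes real and nonnegative there, hence equal to \<open>f\<close>.\<close>
      define c where "c = of_real (norm (F v)) / F v"
      have c: "norm c = 1" using False by (simp add: c_def norm_divide)
      have "F (smul c v) = of_real (norm (F v))" using False by (simp add: F_scale c_def)
      then have *: "of_real (f (smul c v) - norm (F v)) - of_real (f (smul i (smul c v))) * i = 0"
        by (simp add: F_def algebra_simps)
      have im: "f (smul i (smul c v)) = 0"
      proof -
        have "of_real (f (smul c v) - norm (F v)) = of_real (f (smul i (smul c v))) * i"
          using * by (simp only: eq_iff_diff_eq_0[symmetric])
        then have "of_real ((f (smul c v) - norm (F v))\<^sup>2)
            = of_real ((f (smul i (smul c v)))\<^sup>2) * (i * i)"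
          by (metis (no_types, lifting) of_real_power power2_eq_square power_mult_distrib)
        then have "of_real ((f (smul c v) - norm (F v))\<^sup>2 + (f (smul i (smul c v)))\<^sup>2) = (0::'f)"
          by (simp add: 2(1))
        then show ?thesis by (simp only: of_real_eq_0_iff sum_power2_eq_zero_iff)
      qed
      then have "f (smul c v) = norm (F v)" using * by (simp flip: of_real_diff)
      then show ?thesis using le[of "smul c v"] by (simp add: norm_scale c)
    qed simp
    have "norm (of_real (norm x) + of_real (- f (smul i x)) * i) \<le> norm x"
      using F_le[of x] by (simp add: F_def x)
    then have "- f (smul i x) = 0" by (rule imaginary_part_zero[OF 2(1)])
    then have "F x = of_real (norm x)" by (simp add: F_def x)
    moreover have "F y = 0" using y[of 1] y[of i] by (simp add: F_def)
    ultimately show ?thesis using that F_add F_scale F_le by blast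
  qed
qed

text \<open>James' characterisation of orthogonality. The distance \<open>q\<close> to the line spanned by \<open>y\<close> is a
  seminorm, and orthogonality means \<open>q x = \<parallel>x\<parallel>\<close>. A linear functional below \<open>q\<close> is nonpositive on the
  line, hence zero there. The case \<open>y = 0\<close> provides norming functionals.\<close>

lemma (in normed_space_over) bj_orth_imp_support_functional:
  assumes bj: "bj_orth smul norm x y"
  obtains F where "\<And>v w. F (v + w) = F v + F w" "\<And>c v. F (smul c v) = c * F v"
    "\<And>v. norm (F v) \<le> norm v" "F x = of_real (norm x)" "F y = 0"
proof -
  define q where "q v = (INF c. norm (v + smul c y))" for v
  have lower: "q v \<le> norm (v + smul c y)" for v c
    unfolding q_def by (intro cINF_lower bdd_belowI2[of _ 0]) auto
  have greatest: "m \<le> q v" if "\<And>c. m \<le> norm (v + smul c y)" for m v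
    unfolding q_def using that by (intro cINF_greatest) auto
  have "sublinear q"
    unfolding sublinear_def
  proof (intro conjI allI impI)
    fix v w
    have "q (v + w) - norm (w + smul d y) \<le> norm (v + smul c y)" for c d
    proof -
      have "q (v + w) \<le> norm ((v + smul c y) + (w + smul d y))"
        using lower[of "v + w" "c + d"] by (simp add: scale_left_distrib algebra_simps)
      then show ?thesis using norm_triangle_ineq[of "v + smul c y" "w + smul d y"] by simp
    qed
    then have "q (v + w) - norm (w + smul d y) \<le> q v" for d by (intro greatest)
    then have "q (v + w) - q v \<le> q w" by (intro greatest) (simp add: algebra_simps)
    then show "q (v + w) \<le> q v + q w" by simp
  next
    fix t :: real and v
    assume t: "0 \<le> t"
    show "q (t *\<^sub>R v) \<le> t * q v"
    proof (cases "t = 0")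
      case True
      then show ?thesis using lower[of 0 0] by simp
    next
      case False
      have "q (t *\<^sub>R v) / t \<le> norm (v + smul c y)" for c
      proof -
        have "t *\<^sub>R v + smul (of_real t * c) y = t *\<^sub>R (v + smul c y)"
          by (simp only: scale_scale[symmetric] scale_of_real scaleR_add_right)
        then have "q (t *\<^sub>R v) \<le> t * norm (v + smul c y)"
          using lower[of "t *\<^sub>R v" "of_real t * c"] t by simp
        then show ?thesis using t False by (simp add: field_simps)
      qed
      then have "q (t *\<^sub>R v) / t \<le> q v" by (rule greatest)
      then show ?thesis using t False by (simp add: field_simps)
    qed
  qed
  then obtain f where f: "linear f" "\<And>v. f v \<le> q v" "f x = q x"
    using exists_linear_minorant by blast
  have q_norm: "q v \<le> norm v" for v using lower[of v 0] by simp
  have "norm x \<le> q x" using bj by (intro greatest) (simp add: bj_orth_def)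
  then have "f x = norm x" using f(3) q_norm[of x] by simp
  moreover have "f (smul c y) = 0" for c
  proof -
    have nonpos: "f (smul c y) \<le> 0" for c
      using f(2)[of "smul c y"] lower[of "smul c y" "- c"] by simp
    have "f (smul (- c) y) = - f (smul c y)" by (simp add: linear_neg[OF f(1)])
    then show ?thesis using nonpos[of c] nonpos[of "- c"] by simp
  qed
  moreover have "f v \<le> norm v" for v using f(2)[of v] q_norm[of v] by simp
  ultimately show ?thesis using real_linear_imp_scalar_linear[OF f(1)] that by blast
qed

text \<open>The bound \<open>norm (F v) \<le> norm v\<close> makes the dual norm at most 1, and it is attained at
  \<open>x\<close>, which lies in \<open>V\<close>.\<close>

lemma (in normed_space_over) restrict_in_support_functionals:
  assumes V: "\<And>v w. v \<in> V \<Longrightarrow> w \<in> V \<Longrightarrow> v + w \<in> V" "\<And>c v. v \<in> V \<Longrightarrow> smul c v \<in> V"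
    and x: "x \<in> V" "x \<noteq> 0"
    and F: "\<And>v w. F (v + w) = F v + F w" "\<And>c v. F (smul c v) = c * F v"
      "\<And>v. norm (F v) \<le> norm v" "F x = of_real (norm x)"
  shows "restrict F V \<in> support_functionals smul V x"
proof -
  have "dual_norm V (restrict F V) = 1"
    unfolding dual_norm_def
  proof (rule antisym)
    have le: "norm (restrict F V v) / norm v \<le> 1" if "v \<in> V" for v
      using F(3)[of v] that by (simp add: divide_le_eq_1)
    then show "(SUP v\<in>V. norm (restrict F V v) / norm v) \<le> 1"
      using x(1) by (intro cSUP_least) auto
    have "norm (restrict F V x) / norm x = 1" using x F(4) by simp
    then show "1 \<le> (SUP v\<in>V. norm (restrict F V v) / norm v)"
      using le x(1) by (intro cSUP_upper2[of _ _ x] bdd_aboveI2[of _ _ 1]) auto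
  qed
  moreover have "\<exists>B. \<forall>v\<in>V. norm (restrict F V v) \<le> B * norm v"
    using F(3) by (intro exI[of _ 1]) simp
  ultimately show ?thesis
    using V x F by (simp add: support_functionals_def dual_on_def)
qed

section \<open>Compact operators\<close>

lemma (in normed_space_over) normed_space_over_scale_op:
  "normed_space_over
     (scale_op smul :: 'f \<Rightarrow> ('x::real_normed_vector \<Rightarrow>\<^sub>L 'v) \<Rightarrow> ('x \<Rightarrow>\<^sub>L 'v))"
proof
  fix a b c :: 'f and r :: real and T U :: "'x \<Rightarrow>\<^sub>L 'v"
  show "scale_op smul a (T + U) = scale_op smul a T + scale_op smul a U"
    by (rule blinfun_eqI) (simp add: scale_op_apply blinfun.add_left scale_right_distrib)
  show "scale_op smul (a + b) T = scale_op smul a T + scale_op smul b T"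
    by (rule blinfun_eqI) (simp add: scale_op_apply blinfun.add_left scale_left_distrib)
  show scale_scale_op: "scale_op smul a (scale_op smul b T) = scale_op smul (a * b) T" for a b T
    by (rule blinfun_eqI) (simp add: scale_op_apply)
  show one: "scale_op smul 1 T = T" for T
    by (rule blinfun_eqI) (simp add: scale_op_apply)
  show "scale_op smul (of_real r) T = r *\<^sub>R T"
    by (rule blinfun_eqI) (simp add: scale_op_apply blinfun.scaleR_left scale_of_real)
  have le: "norm (scale_op smul c T) \<le> norm c * norm T" for c T
  proof (rule norm_blinfun_bound)
    fix x show "norm (blinfun_apply (scale_op smul c T) x) \<le> norm c * norm T * norm x"
      using mult_left_mono[OF norm_blinfun[of T x], of "norm c"]
      by (simp add: scale_op_apply norm_scale mult.assoc)
  qed simp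
  show "norm (scale_op smul c T) = norm c * norm T"
  proof (cases "c = 0")
    case True
    then show ?thesis using le[of c T] by simp
  next
    case False
    have "norm (scale_op smul (inverse c) (scale_op smul c T))
        \<le> norm (inverse c) * norm (scale_op smul c T)" by (rule le)
    then have "norm T \<le> inverse (norm c) * norm (scale_op smul c T)"
      using False by (simp add: scale_scale_op one norm_inverse)
    then have "norm c * norm T \<le> norm (scale_op smul c T)"
      using False by (simp add: field_simps)
    then show ?thesis using le[of c T] by simp
  qed
qed

lemma compact_map_euclideanI:
  fixes f :: "'x::real_normed_vector \<Rightarrow> 'y::real_normed_vector"
  assumes "compact K" "f ` cball 0 1 \<subseteq> K"
  shows "compact_map euclidean f"
proof -
  have "closure (f ` cball 0 1) \<subseteq> K"
    using assms by (intro closure_minimal compact_imp_closed)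
  then show ?thesis
    using assms(1) by (simp add: compact_map_def)
      (metis closed_closure compact_Int_closed inf.absorb2)
qed

lemma (in normed_space_over) compact_ops_add:
  assumes "T \<in> compact_ops scaleX smul" "U \<in> compact_ops scaleX smul"
  shows "T + U \<in> compact_ops scaleX smul"
proof -
  let ?K = "\<lambda>T. closure (blinfun_apply T ` cball 0 1)"
  have K: "compact (?K T)" "compact (?K U)"
    using assms by (auto simp: compact_ops_def compact_map_def)
  have "compact_map euclidean (blinfun_apply (T + U))"
  proof (rule compact_map_euclideanI)
    show "compact {y + z |y z. y \<in> ?K T \<and> z \<in> ?K U}" by (rule compact_sums[OF K])
    show "blinfun_apply (T + U) ` cball 0 1 \<subseteq> {y + z |y z. y \<in> ?K T \<and> z \<in> ?K U}"
      by (auto simp: blinfun.add_left intro!: exI closure_subset[THEN subsetD] imageI)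
  qed
  then show ?thesis
    using assms
    by (simp add: compact_ops_def Vector_Spaces.linear_iff blinfun.add_left
        scale_right_distrib add_ac)
qed

lemma (in normed_space_over) compact_ops_scale:
  assumes T: "T \<in> compact_ops scaleX smul"
  shows "scale_op smul c T \<in> compact_ops scaleX smul"
proof -
  let ?K = "closure (blinfun_apply T ` cball 0 1)"
  have "compact ?K"
    using T by (auto simp: compact_ops_def compact_map_def)
  then have "compact (smul c ` ?K)"
    by (intro compact_continuous_image linear_continuous_on bounded_linear_scale)
  then have "compact_map euclidean (blinfun_apply (scale_op smul c T))"
    by (rule compact_map_euclideanI)
      (auto simp: scale_op_apply intro!: imageI closure_subset[THEN subsetD])
  then show ?thesis
    using T by (auto simp: compact_ops_def Vector_Spaces.linear_iff scale_op_apply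
        scale_right_distrib mult.commute)
qed

text \<open>Smoothness identifies the support functional of \<open>T\<close> that vanishes at \<open>U\<close> with the functional
  \<open>A \<mapsto> g (A x)\<close>, where \<open>g\<close> norms \<open>T x\<close>; hence \<open>g (U x) = 0\<close>.\<close>

lemma smooth_bj_orth_imp_bj_orth_at:
  assumes Y: "normed_space_over scaleY"
    and smooth: "smooth_in (scale_op scaleY) (compact_ops scaleX scaleY) T"
    and U: "U \<in> compact_ops scaleX scaleY"
    and bj: "bj_orth (scale_op scaleY) norm T U"
    and x: "x \<in> norm_attainment_set T"
  shows "bj_orth scaleY norm (blinfun_apply T x) (blinfun_apply U x)"
proof -
  interpret Y: normed_space_over scaleY by (rule Y)
  interpret L: normed_space_over "scale_op scaleY" by (rule Y.normed_space_over_scale_op)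
  let ?V = "compact_ops scaleX scaleY"
  have T: "T \<in> ?V" "T \<noteq> 0" and single: "is_singleton (support_functionals (scale_op scaleY) ?V T)"
    using smooth by (auto simp: smooth_in_def)
  have x_norm: "norm x = 1" "norm (blinfun_apply T x) = norm T"
    using x by (auto simp: norm_attainment_set_def)
  obtain F where F: "\<And>v w. F (v + w) = F v + F w" "\<And>c v. F (scale_op scaleY c v) = c * F v"
      "\<And>v. norm (F v) \<le> norm v" "F T = of_real (norm T)" "F U = 0"
    by (rule L.bj_orth_imp_support_functional[OF bj]) blast
  \<comment> \<open>Every vector is orthogonal to 0; this yields a functional norming \<open>T x\<close>.\<close>
  have "bj_orth scaleY norm (blinfun_apply T x) 0" by (simp add: bj_orth_def)
  then obtain g where g: "\<And>v w. g (v + w) = g v + g w" "\<And>c v. g (scaleY c v) = c * g v"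
      "\<And>v. norm (g v) \<le> norm v" "g (blinfun_apply T x) = of_real (norm (blinfun_apply T x))"
    by (rule Y.bj_orth_imp_support_functional) blast
  define G where "G A = g (blinfun_apply A x)" for A
  have "norm (G A) \<le> norm A" for A
    using g(3)[of "blinfun_apply A x"] norm_blinfun[of A x] by (simp add: G_def x_norm)
  then have "restrict G ?V \<in> support_functionals (scale_op scaleY) ?V T"
    using T by (intro L.restrict_in_support_functionals Y.compact_ops_add Y.compact_ops_scale)
      (auto simp: G_def blinfun.add_left Y.scale_op_apply g x_norm)
  moreover have "restrict F ?V \<in> support_functionals (scale_op scaleY) ?V T"
    using T F by (intro L.restrict_in_support_functionals Y.compact_ops_add Y.compact_ops_scale) auto
  ultimately have "restrict G ?V = restrict F ?V"
    using single by (metis is_singletonE singletonD)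
  then have "G U = F U" using U by (metis restrict_apply')
  then have gU: "g (blinfun_apply U x) = 0" by (simp add: G_def F(5))
  show ?thesis
    unfolding bj_orth_def
  proof
    fix c
    have "g (blinfun_apply T x + scaleY c (blinfun_apply U x)) = of_real (norm (blinfun_apply T x))"
      by (simp add: g gU)
    then show "norm (blinfun_apply T x) \<le> norm (blinfun_apply T x + scaleY c (blinfun_apply U x))"
      using g(3)[of "blinfun_apply T x + scaleY c (blinfun_apply U x)"] by simp
  qed
qed

section \<open>Norms of tuples\<close>

lemma lp_norm_nonneg: "0 \<le> lp_norm p y"
  by (simp add: lp_norm_def)

lemma lp_norm_powr: "p \<noteq> 0 \<Longrightarrow> lp_norm p y powr p = (\<Sum>k\<in>UNIV. norm (y $ k) powr p)"
  by (simp add: lp_norm_def powr_powr sum_nonneg)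

lemma lp_norm_mono:
  assumes "1 \<le> p" "\<And>k. norm (y $ k) \<le> norm (z $ k)"
  shows "lp_norm p y \<le> lp_norm p z"
  unfolding lp_norm_def using assms by (intro powr_mono2 sum_mono sum_nonneg) auto

lemma lp_norm_strict_mono:
  assumes p: "1 \<le> p" and le: "\<And>k. norm (y $ k) \<le> norm (z $ k)"
    and less: "norm (y $ j) < norm (z $ j)"
  shows "lp_norm p y < lp_norm p z"
proof -
  have "(\<Sum>k\<in>UNIV. norm (y $ k) powr p) < (\<Sum>k\<in>UNIV. norm (z $ k) powr p)"
    using p le less by (intro sum_strict_mono_ex1)
      (auto intro!: powr_mono2 powr_less_mono2)
  then show ?thesis
    unfolding lp_norm_def using p by (intro powr_less_mono2) (auto intro!: sum_nonneg)
qed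

lemma lp_norm_scaleR:
  assumes "1 \<le> p" shows "lp_norm p (r *\<^sub>R y) = \<bar>r\<bar> * lp_norm p y"
proof -
  have "(\<Sum>k\<in>UNIV. norm ((r *\<^sub>R y) $ k) powr p) = \<bar>r\<bar> powr p * (\<Sum>k\<in>UNIV. norm (y $ k) powr p)"
    by (simp add: powr_mult sum_distrib_left)
  then show ?thesis
    using assms by (simp add: lp_norm_def powr_mult powr_powr sum_nonneg)
qed

lemma norm_component_le_lp_norm:
  assumes p: "1 \<le> p" shows "norm (y $ k) \<le> lp_norm p y"
proof -
  have "norm (y $ k) powr p \<le> (\<Sum>k\<in>UNIV. norm (y $ k) powr p)"
    by (rule member_le_sum) auto
  then have "(norm (y $ k) powr p) powr (1 / p) \<le> lp_norm p y"
    unfolding lp_norm_def using p by (intro powr_mono2) auto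
  then show ?thesis using p by (simp add: powr_powr)
qed

text \<open>On the open half-line this is convexity of the power function; if one of the points is 0,
  it reduces to \<open>c powr p \<le> c\<close> for a weight \<open>c\<close>.\<close>

lemma powr_convex_combination:
  fixes p :: real
  assumes p: "1 \<le> p" and "0 \<le> a" "0 \<le> b" "a + b = 1" "0 \<le> s" "0 \<le> t"
  shows "(a * s + b * t) powr p \<le> a * s powr p + b * t powr p"
proof -
  have single: "(c * r) powr p \<le> c * r powr p" if "0 \<le> c" "c \<le> 1" "0 \<le> r" for c r
  proof -
    have "c powr p \<le> c"
      using powr_mono'[of 1 p c] p that by simp
    then show ?thesis using that by (simp add: powr_mult mult_right_mono)
  qed
  show ?thesis
  proof (cases "s = 0 \<or> t = 0")
    case True
    then show ?thesis using single[of a s] single[of b t] assms by auto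
  next
    case False
    then show ?thesis
      using convex_onD[OF powr_convex[OF p], of b s t] assms by (simp add: eq_diff_eq[symmetric])
  qed
qed

text \<open>Minkowski's inequality. With \<open>a\<close> and \<open>b\<close> the norms of \<open>u\<close> and \<open>v\<close>, the components of
  \<open>(u + v) / (a + b)\<close> are bounded by convex combinations, with weights \<open>a / (a + b)\<close> and \<open>b / (a + b)\<close>,
  of the components of \<open>u / a\<close> and \<open>v / b\<close>, both of which have norm 1. Convexity of the \<open>p\<close>-th power
  finishes the proof.\<close>

lemma lp_norm_triangle:
  assumes p: "1 \<le> p" shows "lp_norm p (u + v) \<le> lp_norm p u + lp_norm p v"
proof -
  have zero: "w = 0" if "lp_norm p w = 0" for w :: "'a ^ 'b"
    using norm_component_le_lp_norm[OF p, of w] that by (simp add: vec_eq_iff)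
  define a b where "a = lp_norm p u" and "b = lp_norm p v"
  show ?thesis
  proof (cases "a = 0 \<or> b = 0")
    case True
    then show ?thesis using zero[of u] zero[of v] lp_norm_nonneg[of p] by (auto simp: a_def b_def)
  next
    case False
    then have ab: "a > 0" "b > 0"
      using lp_norm_nonneg[of p u] lp_norm_nonneg[of p v] by (auto simp: a_def b_def)
    let ?s = "a + b"
    have "norm ((u + v) $ k) powr p
        \<le> ?s powr p * (a / ?s * (norm (u $ k) / a) powr p + b / ?s * (norm (v $ k) / b) powr p)" for k
    proof -
      have "norm ((u + v) $ k) \<le> ?s * (a / ?s * (norm (u $ k) / a) + b / ?s * (norm (v $ k) / b))"
        using ab norm_triangle_ineq[of "u $ k" "v $ k"] by (simp add: distrib_left)
      then have "norm ((u + v) $ k) powr p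
          \<le> (?s * (a / ?s * (norm (u $ k) / a) + b / ?s * (norm (v $ k) / b))) powr p"
        using p by (intro powr_mono2) auto
      also have "\<dots> = ?s powr p * (a / ?s * (norm (u $ k) / a) + b / ?s * (norm (v $ k) / b)) powr p"
        using ab by (intro powr_mult)
      also have "\<dots> \<le> ?s powr p * (a / ?s * (norm (u $ k) / a) powr p + b / ?s * (norm (v $ k) / b) powr p)"
        using ab p
        by (intro mult_left_mono powr_convex_combination) (auto simp: add_divide_distrib[symmetric])
      finally show ?thesis .
    qed
    then have "(\<Sum>k\<in>UNIV. norm ((u + v) $ k) powr p)
        \<le> (\<Sum>k\<in>UNIV. ?s powr p * (a / ?s * (norm (u $ k) / a) powr p + b / ?s * (norm (v $ k) / b) powr p))"
      by (intro sum_mono)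
    also have "\<dots> = ?s powr p * (a / ?s * ((\<Sum>k\<in>UNIV. norm (u $ k) powr p) / a powr p)
        + b / ?s * ((\<Sum>k\<in>UNIV. norm (v $ k) powr p) / b powr p))"
      using ab by (simp add: powr_divide sum.distrib sum_distrib_left sum_divide_distrib distrib_left)
    also have "\<dots> = ?s powr p"
    proof -
      have "(\<Sum>k\<in>UNIV. norm (u $ k) powr p) = a powr p" "(\<Sum>k\<in>UNIV. norm (v $ k) powr p) = b powr p"
        using p lp_norm_powr[of p u] lp_norm_powr[of p v] by (auto simp: a_def b_def)
      then show ?thesis using ab by (simp add: add_divide_distrib[symmetric])
    qed
    finally have "lp_norm p (u + v) \<le> (?s powr p) powr (1 / p)"
      unfolding lp_norm_def[of p "u + v"] using p by (intro powr_mono2) (auto intro!: sum_nonneg)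
    then show ?thesis using ab p by (simp add: powr_powr a_def b_def)
  qed
qed

lemma Metric_space_lp_norm:
  assumes p: "1 \<le> p"
  shows "Metric_space UNIV (\<lambda>u v :: 'y::real_normed_vector ^ 'd. lp_norm p (u - v))"
proof
  fix u v w :: "'y ^ 'd"
  show "0 \<le> lp_norm p (u - v)" by (rule lp_norm_nonneg)
  show "lp_norm p (u - v) = lp_norm p (v - u)"
    using lp_norm_scaleR[OF p, of "- 1" "u - v"] by simp
  show "lp_norm p (u - v) = 0 \<longleftrightarrow> u = v"
  proof
    assume "lp_norm p (u - v) = 0"
    then show "u = v"
      using norm_component_le_lp_norm[OF p, of "u - v"] by (simp add: vec_eq_iff)
  qed (use p in \<open>simp add: lp_norm_def\<close>)
  show "lp_norm p (u - w) \<le> lp_norm p (u - v) + lp_norm p (v - w)"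
    using lp_norm_triangle[OF p, of "u - v" "v - w"] by simp
qed

text \<open>Projections to components are 1-Lipschitz for the \<open>p\<close>-norm, so they carry the compact closure of
  the image of the unit ball to a compact set.\<close>

lemma compact_tuples_component:
  fixes S :: "('x::real_normed_vector \<Rightarrow>\<^sub>L 'y::real_normed_vector) ^ 'd"
  assumes p: "1 \<le> p" and X: "normed_space_over scaleX" and Y: "normed_space_over scaleY"
    and S: "S \<in> compact_tuples p scaleX scaleY"
  shows "S $ k \<in> compact_ops scaleX scaleY"
proof -
  let ?K = "lp_topology p closure_of (tuple_op S ` cball 0 1)"
  interpret Metric_space UNIV "\<lambda>u v :: 'y ^ 'd. lp_norm p (u - v)"
    by (rule Metric_space_lp_norm[OF p])
  have "continuous_map (lp_topology p) euclidean (\<lambda>y :: 'y ^ 'd. y $ k)"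
  proof -
    have "continuous_map mtopology Met_TC.mtopology (\<lambda>y. y $ k)"
      unfolding metric_continuous_map[OF Met_TC.Metric_space_axioms]
    proof (intro conjI ballI allI impI)
      fix u :: "'y ^ 'd" and e :: real
      assume "e > 0"
      have "dist (u $ k) (v $ k) \<le> lp_norm p (u - v)" for v
        using norm_component_le_lp_norm[OF p, of "u - v" k] by (simp add: dist_norm)
      then show "\<exists>d>0. \<forall>v. v \<in> UNIV \<and> lp_norm p (u - v) < d \<longrightarrow> dist (u $ k) (v $ k) < e"
        using \<open>e > 0\<close> le_less_trans by blast
    qed simp
    then show ?thesis by (simp add: lp_topology_def)
  qed
  moreover have "compactin (lp_topology p) ?K"
    using S by (simp add: compact_tuples_def compact_map_def)
  ultimately have "compact ((\<lambda>y. y $ k) ` ?K)"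
    using image_compactin by fastforce
  moreover have "blinfun_apply (S $ k) ` cball 0 1 \<subseteq> (\<lambda>y. y $ k) ` ?K"
  proof -
    have "tuple_op S ` cball 0 1 \<subseteq> ?K"
      by (rule closure_of_subset) (simp add: lp_topology_def)
    then have "(\<lambda>y. y $ k) ` tuple_op S ` cball 0 1 \<subseteq> (\<lambda>y. y $ k) ` ?K" by (rule image_mono)
    then show ?thesis by (simp add: image_image tuple_op_def)
  qed
  ultimately have "compact_map euclidean (blinfun_apply (S $ k))" by (rule compact_map_euclideanI)
  moreover have "Vector_Spaces.linear scaleX scaleY (blinfun_apply (S $ k))"
    using S X Y
    by (auto simp: compact_tuples_def Vector_Spaces.linear_iff normed_space_over_def tuple_op_def
        vec_eq_iff)
  ultimately show ?thesis by (simp add: compact_ops_def)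
qed

lemma lp_norm_tuple_op_le:
  assumes p: "1 \<le> p" shows "lp_norm p (tuple_op T x) \<le> lp_norm p T * norm x"
proof -
  have "lp_norm p (tuple_op T x) \<le> lp_norm p (norm x *\<^sub>R T)"
    using norm_blinfun by (intro lp_norm_mono[OF p]) (simp add: tuple_op_def mult.commute)
  then show ?thesis by (simp add: lp_norm_scaleR[OF p] mult.commute)
qed

lemma tuple_norm_quotient_le:
  assumes "1 \<le> p" shows "lp_norm p (tuple_op T x) / norm x \<le> lp_norm p T"
  using lp_norm_tuple_op_le[OF assms, of T x]
  by (cases "x = 0") (auto simp: field_simps lp_norm_nonneg)

lemma tuple_norm_le_lp_norm: "1 \<le> p \<Longrightarrow> tuple_norm p T \<le> lp_norm p T"
  unfolding tuple_norm_def by (intro cSUP_least) (auto intro: tuple_norm_quotient_le)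

lemma lp_norm_tuple_op_le_tuple_norm:
  assumes "1 \<le> p" "norm x = 1" shows "lp_norm p (tuple_op T x) \<le> tuple_norm p T"
proof -
  have "lp_norm p (tuple_op T x) / norm x \<le> tuple_norm p T"
    unfolding tuple_norm_def
    by (intro cSUP_upper bdd_aboveI2[of _ _ "lp_norm p T"] tuple_norm_quotient_le assms(1)) simp
  then show ?thesis using assms(2) by simp
qed

text \<open>A common norming vector realizes all component norms at once.\<close>

lemma tuple_norm_eq_lp_norm:
  assumes p: "1 \<le> p" and x: "\<And>i. x \<in> norm_attainment_set (T $ i)"
  shows "tuple_norm p T = lp_norm p T"
proof (rule antisym)
  have "lp_norm p T \<le> lp_norm p (tuple_op T x)"
    using x by (intro lp_norm_mono[OF p]) (simp add: norm_attainment_set_def tuple_op_def)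
  also have "\<dots> \<le> tuple_norm p T"
    using x by (intro lp_norm_tuple_op_le_tuple_norm[OF p]) (auto simp: norm_attainment_set_def)
  finally show "lp_norm p T \<le> tuple_norm p T" .
qed (rule tuple_norm_le_lp_norm[OF p])

section \<open>Orthogonality of tuples\<close>

text \<open>A perturbation of the \<open>j\<close>-th component alone that decreases its norm strictly decreases the
  \<open>p\<close>-norm of the component norms. That number equals the tuple norm at \<open>T\<close> and is an upper bound
  for it elsewhere, so the tuple norm would decrease as well.\<close>

lemma bj_orth_components_if_bj_orth_tuple:
  assumes p: "1 \<le> p" and Y: "normed_space_over scaleY"
    and x: "\<And>i. x \<in> norm_attainment_set (T $ i)"
    and bj: "bj_orth_set (tuple_scale scaleY) (tuple_norm p) T (range (\<lambda>z. tuple_mult scaleY z S))"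
  shows "bj_orth (scale_op scaleY) norm (T $ j) (S $ j)"
  unfolding bj_orth_def
proof (rule allI, rule ccontr)
  interpret Y: normed_space_over scaleY by (rule Y)
  interpret L: normed_space_over "scale_op scaleY" by (rule Y.normed_space_over_scale_op)
  fix c
  assume "\<not> norm (T $ j) \<le> norm (T $ j + scale_op scaleY c (S $ j))"
  then have less: "norm (T $ j + scale_op scaleY c (S $ j)) < norm (T $ j)" by simp
  define w where "w = tuple_mult scaleY (axis j c) S"
  have comp: "(T + tuple_scale scaleY 1 w) $ k
      = (if k = j then T $ j + scale_op scaleY c (S $ j) else T $ k)" for k
    by (simp add: w_def tuple_scale_def tuple_mult_def axis_def)
  have "lp_norm p T = tuple_norm p T" by (rule tuple_norm_eq_lp_norm[OF p x, symmetric])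
  also have "\<dots> \<le> tuple_norm p (T + tuple_scale scaleY 1 w)"
    using bj by (simp add: bj_orth_set_def bj_orth_def w_def)
  also have "\<dots> \<le> lp_norm p (T + tuple_scale scaleY 1 w)"
    by (rule tuple_norm_le_lp_norm[OF p])
  also have "\<dots> < lp_norm p T"
    using less by (intro lp_norm_strict_mono[OF p, of _ _ j])
      (auto simp: comp simp del: vector_add_component)
  finally show False by simp
qed

text \<open>At \<open>x\<close> no perturbation decreases the norm of any component, and the value of \<open>T\<close> at \<open>x\<close>
  already has the full tuple norm.\<close>

lemma bj_orth_tuple_if_bj_orth_at:
  assumes p: "1 \<le> p" and Y: "normed_space_over scaleY"
    and x: "\<And>i. x \<in> norm_attainment_set (T $ i)"
    and bj: "\<And>j. bj_orth scaleY norm (blinfun_apply (T $ j) x) (blinfun_apply (S $ j) x)"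
  shows "bj_orth_set (tuple_scale scaleY) (tuple_norm p) T (range (\<lambda>z. tuple_mult scaleY z S))"
  unfolding bj_orth_set_def bj_orth_def
proof (intro ballI allI)
  interpret Y: normed_space_over scaleY by (rule Y)
  fix w c
  assume "w \<in> range (\<lambda>z. tuple_mult scaleY z S)"
  then obtain z where w: "w = tuple_mult scaleY z S" by blast
  let ?U = "T + tuple_scale scaleY c w"
  have "norm (T $ k) \<le> norm (tuple_op ?U x $ k)" for k
  proof -
    have "tuple_op ?U x $ k
        = blinfun_apply (T $ k) x + scaleY (c * z $ k) (blinfun_apply (S $ k) x)"
      by (simp add: w tuple_op_def tuple_scale_def tuple_mult_def blinfun.add_left Y.scale_op_apply)
    moreover have "norm (T $ k) = norm (blinfun_apply (T $ k) x)"
      using x[of k] by (simp add: norm_attainment_set_def)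
    ultimately show ?thesis using bj[of k] by (simp add: bj_orth_def)
  qed
  then have "lp_norm p T \<le> lp_norm p (tuple_op ?U x)" by (rule lp_norm_mono[OF p])
  also have "\<dots> \<le> tuple_norm p ?U"
    using x by (intro lp_norm_tuple_op_le_tuple_norm[OF p]) (auto simp: norm_attainment_set_def)
  finally show "tuple_norm p T \<le> tuple_norm p ?U"
    by (simp only: tuple_norm_eq_lp_norm[OF p x])
qed

theorem corollary2p9:
  fixes p :: real
    and scaleX :: "'f::real_or_complex \<Rightarrow> 'x::banach \<Rightarrow> 'x"
    and scaleY :: "'f \<Rightarrow> 'y::banach \<Rightarrow> 'y"
    and T S :: "('x \<Rightarrow>\<^sub>L 'y) ^ 'd"
  assumes "1 \<le> p"
    and "normed_space_over scaleX" and "reflexive_space scaleX"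
    and "normed_space_over scaleY"
    and "T \<in> compact_tuples p scaleX scaleY" and "S \<in> compact_tuples p scaleX scaleY"
    and "(\<Inter>i. norm_attainment_set (T $ i)) \<noteq> {}"
  shows "(bj_orth_set (tuple_scale scaleY) (tuple_norm p) T (range (\<lambda>z. tuple_mult scaleY z S))
            \<longrightarrow> (\<forall>j. bj_orth (scale_op scaleY) norm (T $ j) (S $ j)))
       \<and> ((\<forall>j. smooth_in (scale_op scaleY) (compact_ops scaleX scaleY) (T $ j))
            \<longrightarrow> (\<forall>j. bj_orth (scale_op scaleY) norm (T $ j) (S $ j))
            \<longrightarrow> bj_orth_set (tuple_scale scaleY) (tuple_norm p) T
                  (range (\<lambda>z. tuple_mult scaleY z S)))"
proof -
  obtain x where x: "\<And>i. x \<in> norm_attainment_set (T $ i)" using assms(7) by auto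
  have S: "S $ j \<in> compact_ops scaleX scaleY" for j
    by (rule compact_tuples_component[OF assms(1,2,4,6)])
  show ?thesis
  proof (intro conjI impI allI)
    fix j
    assume "bj_orth_set (tuple_scale scaleY) (tuple_norm p) T (range (\<lambda>z. tuple_mult scaleY z S))"
    then show "bj_orth (scale_op scaleY) norm (T $ j) (S $ j)"
      by (rule bj_orth_components_if_bj_orth_tuple[OF assms(1,4) x])
  next
    assume smooth: "\<forall>j. smooth_in (scale_op scaleY) (compact_ops scaleX scaleY) (T $ j)"
      and bj: "\<forall>j. bj_orth (scale_op scaleY) norm (T $ j) (S $ j)"
    show "bj_orth_set (tuple_scale scaleY) (tuple_norm p) T (range (\<lambda>z. tuple_mult scaleY z S))"
      using smooth bj x S
      by (intro bj_orth_tuple_if_bj_orth_at[OF assms(1,4) x] smooth_bj_orth_imp_bj_orth_at[OF assms(4)])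
        auto
  qed
qed

end
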